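(* Let $\mathcal D^\infty$ and $\mathcal E^\infty$ be two $\digamma$-parallel $\digamma$-lines of $\mathbb R^2$. Then there exist $a\in\mathbb R^2$ and $c,d\in\mathbb R$ such that $$\mathcal D^\infty=\{z\in\mathbb R^2:\ \langle a,z\rangle_\infty^-\le c\le\langle a,z\rangle_\infty^+\}$$ and $$\mathcal E^\infty=\{z\in\mathbb R^2:\ \langle a,z\rangle_\infty^-\le d\le\langle a,z\rangle_\infty^+\}.$$
   Context: For $u\in\mathbb R^m$, the $m$-ary operation $u_1\boxplus\cdots\boxplus u_m$ (not an iteration of a binary operation) is $\lim_{p\to\infty}\big(\sum_{i=1}^m u_i^{2p+1}\big)^{1/(2p+1)}$. Explicitly: discard every index $i$ with $\mathrm{Card}\{j:u_j=u_i\}=\mathrm{Card}\{j:u_j=-u_i\}$; if no index remains the value is $0$; otherwise let $M$ be the maximum of $|u_i|$ over the remaining indices; the value is $M$ if $\mathrm{Card}\{j:u_j=M\}>\mathrm{Card}\{j:u_j=-M\}$ and $-M$ otherwise. For vectors it is applied coordinatewise, and $x\boxminus y=x\boxplus(-y)$. For $x\ne y$ in $\mathbb R^2$, the $\digamma$-line spanned by $x$ and $y$ is $\mathcal D^\infty(x,y)=\{tx\boxplus rx\boxplus sy\boxplus wy:\ t\boxplus r\boxplus s\boxplus w=1,\ t,r,s,w\in\mathbb R\}$ (4-ary operations). Two $\digamma$-lines, spanned by $x,y$ ($x\neq y$) and by $u,v$ ($u\ne v$) respectively, are $\digamma$-parallel if there is $\alpha\in\mathbb R\setminus\{0\}$ with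 $x\boxminus y=\alpha(u\boxminus v)$. For $u,v\in\mathbb R$: $u\stackrel{-}{\smile}v=u$ if $|u|>|v|$, $\min\{u,v\}$ if $|u|=|v|$, $v$ if $|u|<|v|$; and $u\stackrel{+}{\smile}v=-[(-u)\stackrel{-}{\smile}(-v)]$. For $a,z\in\mathbb R^2$: $\langle a,z\rangle_\infty^-=a_1z_1\stackrel{-}{\smile}a_2z_2$ and $\langle a,z\rangle_\infty^+=a_1z_1\stackrel{+}{\smile}a_2z_2$. *)

theory Defs
  imports "HOL-Analysis.Analysis"
begin

text \<open>The \<open>m\<close>-ary operation \<open>u\<^sub>1 \<boxplus> \<dots> \<boxplus> u\<^sub>m\<close> is not an iterated binary operation
  (it is not associative), so it takes the list of all its arguments. The function \<open>root n\<close>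
  is the real root, which for odd \<open>n\<close> is the inverse of \<open>x \<mapsto> x ^ n\<close> on all of
  the reals. The limit always exists; see \<open>boxsum_LIMSEQ\<close> below.\<close>

definition boxsum :: "real list \<Rightarrow> real" where
  "boxsum us = lim (\<lambda>p. root (2 * p + 1) (\<Sum>u\<leftarrow>us. u ^ (2 * p + 1)))"

definition boxsum_vec :: "(real ^ 'n) list \<Rightarrow> real ^ 'n" where
  "boxsum_vec vs = (\<chi> i. boxsum (map (\<lambda>v. v $ i) vs))"

definition boxminus_vec :: "real ^ 'n \<Rightarrow> real ^ 'n \<Rightarrow> real ^ 'n" (infixl "\<boxminus>" 65) where
  "x \<boxminus> y = boxsum_vec [x, - y]"

definition digamma_line :: "real ^ 2 \<Rightarrow> real ^ 2 \<Rightarrow> (real ^ 2) set" where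
  "digamma_line x y =
     {boxsum_vec [t *\<^sub>R x, r *\<^sub>R x, s *\<^sub>R y, w *\<^sub>R y] | t r s w. boxsum [t, r, s, w] = 1}"

definition digamma_parallel :: "(real ^ 2) set \<Rightarrow> (real ^ 2) set \<Rightarrow> bool" where
  "digamma_parallel D E \<longleftrightarrow>
     (\<exists>x y u v. x \<noteq> y \<and> D = digamma_line x y \<and> u \<noteq> v \<and> E = digamma_line u v \<and>
        (\<exists>\<alpha>. \<alpha> \<noteq> 0 \<and> x \<boxminus> y = \<alpha> *\<^sub>R (u \<boxminus> v)))"

definition smile_minus :: "real \<Rightarrow> real \<Rightarrow> real" where
  "smile_minus u v = (if \<bar>u\<bar> > \<bar>v\<bar> then u else if \<bar>u\<bar> = \<bar>v\<bar> then min u v else v)"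

definition smile_plus :: "real \<Rightarrow> real \<Rightarrow> real" where
  "smile_plus u v = - smile_minus (- u) (- v)"

definition inner_minus :: "real ^ 2 \<Rightarrow> real ^ 2 \<Rightarrow> real" where
  "inner_minus a z = smile_minus (a $ 1 * z $ 1) (a $ 2 * z $ 2)"

definition inner_plus :: "real ^ 2 \<Rightarrow> real ^ 2 \<Rightarrow> real" where
  "inner_plus a z = smile_plus (a $ 1 * z $ 1) (a $ 2 * z $ 2)"

text \<open>The remainder shows that the limit in the definition of \<open>boxsum\<close> exists and has the
  combinatorial value obtained by cancelling opposite arguments.\<close>

definition uncancelled :: "real list \<Rightarrow> real set" where
  "uncancelled us = {u \<in> set us. count_list us u \<noteq> count_list us (- u)}"

definition boxsum_value :: "real list \<Rightarrow> real" where
  "boxsum_value us =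
     (if uncancelled us = {} then 0
      else let M = Max (abs ` uncancelled us)
           in if count_list us M > count_list us (- M) then M else - M)"

lemma root_odd_LIMSEQ:
  fixes s :: "nat \<Rightarrow> real"
  assumes s: "s \<longlonglongrightarrow> L" and L: "L \<noteq> 0"
  shows "(\<lambda>p. root (2 * p + 1) (s p)) \<longlonglongrightarrow> sgn L"
proof -
  have e: "root (2 * p + 1) (s p) = sgn (s p) * \<bar>s p\<bar> powr inverse (real (2 * p + 1))" for p
  proof -
    have "root (2 * p + 1) x = x powr inverse (real (2 * p + 1))" if "x > 0" for x
      using root_powr_inverse[of "2 * p + 1" x] that by (simp add: divide_inverse)
    from this[of "s p"] this[of "- s p"] show ?thesis
      by (cases "s p" "0 :: real" rule: linorder_cases) (auto simp: real_root_minus)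
  qed
  have "strict_mono (\<lambda>p::nat. 2 * p)"
    by (simp add: strict_mono_def)
  from LIMSEQ_subseq_LIMSEQ[OF LIMSEQ_inverse_real_of_nat this]
  have "(\<lambda>p. inverse (real (2 * p + 1))) \<longlonglongrightarrow> 0"
    by (simp add: o_def add_ac)
  then have "(\<lambda>p. sgn (s p) * \<bar>s p\<bar> powr inverse (real (2 * p + 1))) \<longlonglongrightarrow> sgn L * \<bar>L\<bar> powr 0"
    using s L by (intro tendsto_intros) auto
  then show ?thesis using L e by simp
qed

lemma sum_list_odd_power:
  fixes us :: "real list"
  assumes "odd k"
  shows "(\<Sum>u\<leftarrow>us. u ^ k) = (\<Sum>u\<in>set us \<union> uminus ` set us.
           (real (count_list us u) - real (count_list us (- u))) * u ^ k) / 2"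
proof -
  define S where "S = set us \<union> uminus ` set us"
  have fin: "finite S" by (simp add: S_def)
  have "(\<Sum>u\<leftarrow>vs. u ^ k) = (\<Sum>u\<in>S. real (count_list vs u) * u ^ k)" if "set vs \<subseteq> S" for vs
    using that
  proof (induction vs)
    case (Cons v vs)
    have "(\<Sum>u\<in>S. real (count_list (v # vs) u) * u ^ k) =
          (\<Sum>u\<in>S. (if u = v then v ^ k else 0) + real (count_list vs u) * u ^ k)"
      by (intro sum.cong) (auto simp: algebra_simps)
    also have "\<dots> = v ^ k + (\<Sum>u\<in>S. real (count_list vs u) * u ^ k)"
      using fin Cons.prems by (simp add: sum.distrib)
    finally show ?case using Cons by simp
  qed simp
  then have 1: "(\<Sum>u\<leftarrow>us. u ^ k) = (\<Sum>u\<in>S. real (count_list us u) * u ^ k)"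
    by (simp add: S_def)
  also have "\<dots> = (\<Sum>u\<in>S. real (count_list us (- u)) * (- u) ^ k)"
    by (rule sum.reindex_bij_witness[of _ uminus uminus]) (auto simp: S_def)
  also have "\<dots> = - (\<Sum>u\<in>S. real (count_list us (- u)) * u ^ k)"
    using assms by (simp add: sum_negf)
  finally show ?thesis
    using 1 by (simp add: S_def left_diff_distrib sum_subtractf)
qed

lemma boxsum_LIMSEQ:
  "(\<lambda>p. root (2 * p + 1) (\<Sum>u\<leftarrow>us. u ^ (2 * p + 1))) \<longlonglongrightarrow> boxsum_value us"
proof -
  define n where "n u = real (count_list us u) - real (count_list us (- u))" for u
  define S where "S = set us \<union> uminus ` set us"
  have fin: "finite S" by (simp add: S_def)
  have n_minus: "n (- u) = - n u" for u by (simp add: n_def)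
  have sum_eq: "(\<Sum>u\<leftarrow>us. u ^ (2 * p + 1)) = (\<Sum>u\<in>S. n u * u ^ (2 * p + 1)) / 2" for p
    unfolding n_def S_def by (rule sum_list_odd_power) simp
  have unc: "u \<in> uncancelled us \<longleftrightarrow> u \<in> set us \<and> n u \<noteq> 0" for u
    by (auto simp: uncancelled_def n_def)
  have unc': "u \<in> uncancelled us \<or> - u \<in> uncancelled us" if "n u \<noteq> 0" for u
    using that count_list_0_iff[of us u] count_list_0_iff[of us "- u"]
      by (auto simp: unc n_minus) (auto simp: n_def)
  show ?thesis
  proof (cases "uncancelled us = {}")
    case True
    then have "n u = 0" for u using unc' by blast
    then show ?thesis unfolding sum_eq using True by (simp add: boxsum_value_def)
  next
    case False
    define M where "M = Max (abs ` uncancelled us)"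
    have finU: "finite (abs ` uncancelled us)" by (simp add: uncancelled_def)
    have "M \<in> abs ` uncancelled us" unfolding M_def using finU False by (intro Max_in) auto
    then obtain m where m: "m \<in> uncancelled us" "M = \<bar>m\<bar>" by auto
    have "n 0 = 0" by (simp add: n_def)
    then have M0: "M > 0" using m unc by fastforce
    have nM: "n M \<noteq> 0" using m unc n_minus by (cases "m \<ge> 0") auto
    have MS: "M \<in> S" "- M \<in> S" using m unc by (auto simp: S_def abs_if)
    have le: "\<bar>u\<bar> \<le> M" if "n u \<noteq> 0" for u
      using unc'[OF that] Max_ge[OF finU] by (force simp: M_def)
    have lim1: "(\<lambda>p. n u * (u / M) ^ (2 * p + 1)) \<longlonglongrightarrow>
                  n u * ((if u = M then 1 else 0) - (if u = - M then 1 else 0))" for u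
    proof (cases "n u = 0 \<or> u = M \<or> u = - M")
      case True
      then show ?thesis using M0 by auto
    next
      case F: False
      then have "\<bar>u\<bar> < M" using le[of u] by (auto simp: abs_if split: if_splits)
      then have "\<bar>u / M\<bar> < 1" using M0 by (simp add: abs_divide)
      then have "(\<lambda>k. (u / M) ^ k) \<longlonglongrightarrow> 0" by (intro LIMSEQ_power_zero) simp
      moreover have "strict_mono (\<lambda>p::nat. 2 * p + 1)" by (simp add: strict_mono_def)
      ultimately have "(\<lambda>p. (u / M) ^ (2 * p + 1)) \<longlonglongrightarrow> 0"
        by (auto dest: LIMSEQ_subseq_LIMSEQ simp: o_def)
      from tendsto_mult_left[OF this, of "n u"] show ?thesis using F by simp
    qed
    have "(\<lambda>p. (\<Sum>u\<in>S. n u * (u / M) ^ (2 * p + 1)) / 2) \<longlonglongrightarrow>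
            (\<Sum>u\<in>S. n u * ((if u = M then 1 else 0) - (if u = - M then 1 else 0))) / 2"
      by (intro tendsto_intros lim1) simp
    also have "(\<Sum>u\<in>S. n u * ((if u = M then 1 else 0) - (if u = - M then 1 else 0))) / 2 = n M"
    proof -
      have "(\<Sum>u\<in>S. n u * ((if u = M then 1 else 0) - (if u = - M then 1 else 0))) =
            (\<Sum>u\<in>S. (if u = M then n M else 0) + (if u = - M then n M else 0))"
        using M0 by (intro sum.cong) (auto simp: n_minus)
      then show ?thesis using fin MS by (simp add: sum.distrib)
    qed
    finally have "(\<lambda>p. root (2 * p + 1) ((\<Sum>u\<in>S. n u * (u / M) ^ (2 * p + 1)) / 2))
                    \<longlonglongrightarrow> sgn (n M)"
      using nM by (rule root_odd_LIMSEQ)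
    then have "(\<lambda>p. M * root (2 * p + 1) ((\<Sum>u\<in>S. n u * (u / M) ^ (2 * p + 1)) / 2))
                    \<longlonglongrightarrow> M * sgn (n M)"
      by (rule tendsto_mult_left)
    also have "(\<lambda>p. M * root (2 * p + 1) ((\<Sum>u\<in>S. n u * (u / M) ^ (2 * p + 1)) / 2)) =
               (\<lambda>p. root (2 * p + 1) (\<Sum>u\<leftarrow>us. u ^ (2 * p + 1)))"
    proof
      fix p
      let ?s = "(\<Sum>u\<in>S. n u * (u / M) ^ (2 * p + 1)) / 2"
      have "root (2 * p + 1) (M ^ (2 * p + 1)) = M"
        by (rule real_root_power_cancel) (use M0 in auto)
      then have "M * root (2 * p + 1) ?s = root (2 * p + 1) (M ^ (2 * p + 1) * ?s)"
        by (simp only: real_root_mult)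
      also have "M ^ (2 * p + 1) * ?s = (\<Sum>u\<in>S. M ^ (2 * p + 1) * (n u * (u / M) ^ (2 * p + 1))) / 2"
        by (simp only: sum_distrib_left times_divide_eq_right)
      also have "\<dots> = (\<Sum>u\<in>S. n u * u ^ (2 * p + 1)) / 2"
        using M0 by (intro arg_cong[of _ _ "\<lambda>x. x / 2"] sum.cong refl)
          (simp only: power_divide, simp)
      finally show "M * root (2 * p + 1) ((\<Sum>u\<in>S. n u * (u / M) ^ (2 * p + 1)) / 2) =
                    root (2 * p + 1) (\<Sum>u\<leftarrow>us. u ^ (2 * p + 1))"
        by (simp only: sum_eq)
    qed
    also have "M * sgn (n M) = boxsum_value us"
      using False nM by (auto simp: boxsum_value_def Let_def M_def[symmetric] n_def sgn_if)
    finally show ?thesis .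
  qed
qed

corollary boxsum_eq_value: "boxsum us = boxsum_value us"
  unfolding boxsum_def using boxsum_LIMSEQ by (rule limI)

end

theory Submission
  imports Defs
begin

text \<open>With \<open>a = (y\<^sub>2 \<boxminus> x\<^sub>2, x\<^sub>1 \<boxminus> y\<^sub>1)\<close> and \<open>c = x\<^sub>1y\<^sub>2 \<boxminus> x\<^sub>2y\<^sub>1\<close>, the line through \<open>x\<close> and \<open>y\<close> is
  \<open>{z. \<langle>a,z\<rangle>\<^sup>- \<le> c \<le> \<langle>a,z\<rangle>\<^sup>+}\<close>, and parallel lines have proportional \<open>a\<close>. Every point of the line satisfies
  the inequalities because they are the limit form of the identity
  \<open>(y\<^sub>2 - x\<^sub>2) z\<^sub>1 + (x\<^sub>1 - y\<^sub>1) z\<^sub>2 = (x\<^sub>1y\<^sub>2 - x\<^sub>2y\<^sub>1) (t + r + s + w)\<close> between odd powers. Conversely, the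
  line has points with any prescribed coordinate on which \<open>x\<close> and \<open>y\<close> differ, and the inequalities
  determine the other coordinate, except at the vertex \<open>a\<^sub>1z\<^sub>1 = a\<^sub>2z\<^sub>2 = c \<noteq> 0\<close>, which is reached by explicit
  parameters.\<close>

section \<open>Computation rules for box sums\<close>

lemma boxsum_tendsto:
  "(\<lambda>p. root (2 * p + 1) (\<Sum>u\<leftarrow>us. u ^ (2 * p + 1))) \<longlonglongrightarrow> boxsum us"
  unfolding boxsum_eq_value by (rule boxsum_LIMSEQ)

lemma odd_two_times_plus_one: "odd (2 * p + 1 :: nat)"
  by simp

text \<open>Lets polynomial identities permute or cancel arguments without a case analysis on which
  entries dominate.\<close>

lemma boxsum_cong:
  assumes "\<And>k. odd k \<Longrightarrow> (\<Sum>u\<leftarrow>us. u ^ k) = (\<Sum>u\<leftarrow>vs. u ^ k)"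
  shows "boxsum us = boxsum vs"
  unfolding boxsum_def by (subst assms) simp_all

lemma boxsum_scale: "boxsum (map ((*) k) us) = k * boxsum us"
proof -
  have "(\<Sum>u\<leftarrow>map ((*) k) us. u ^ n) = k ^ n * (\<Sum>u\<leftarrow>us. u ^ n)" for n
    by (simp add: o_def power_mult_distrib sum_list_const_mult)
  then have "(\<lambda>p. root (2 * p + 1) (\<Sum>u\<leftarrow>map ((*) k) us. u ^ (2 * p + 1))) =
      (\<lambda>p. k * root (2 * p + 1) (\<Sum>u\<leftarrow>us. u ^ (2 * p + 1)))"
    by (intro ext) (simp only: real_root_mult odd_real_root_power_cancel[OF odd_two_times_plus_one])
  from boxsum_tendsto[of "map ((*) k) us", unfolded this] tendsto_mult_left[OF boxsum_tendsto]
  show ?thesis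
    by (rule LIMSEQ_unique)
qed

lemma boxsum_eqI:
  assumes "m \<noteq> 0" and gt: "count_list us m > count_list us (- m)"
    and canc: "\<And>u. u \<in> set us \<Longrightarrow> \<bar>u\<bar> > \<bar>m\<bar> \<Longrightarrow> count_list us u = count_list us (- u)"
  shows "boxsum us = m"
proof -
  have "m \<in> set us"
    using gt by (metis count_notin not_less_zero)
  then have mU: "m \<in> uncancelled us"
    using gt by (auto simp: uncancelled_def)
  have "Max (abs ` uncancelled us) = \<bar>m\<bar>"
    by (rule Max_eqI) (use mU canc in \<open>force simp: uncancelled_def\<close>)+
  then show ?thesis
    using mU gt by (auto simp: boxsum_eq_value boxsum_value_def abs_if)
qed

text \<open>On a tie \<open>\<bar>u\<bar> = \<bar>v\<bar>\<close> with \<open>u \<noteq> v\<close>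
  the last two branches agree, since then \<open>u = - v\<close>.\<close>

lemma boxsum_diff: "boxsum [u, - v] = (if u = v then 0 else if \<bar>v\<bar> \<le> \<bar>u\<bar> then u else - v)"
proof (cases "u = v")
  case True
  then show ?thesis by (simp add: boxsum_def)
next
  case False
  then show ?thesis
    by (auto intro!: boxsum_eqI)
qed

lemma boxsum_diff_left: "\<lbrakk>u \<noteq> v; \<bar>v\<bar> \<le> \<bar>u\<bar>\<rbrakk> \<Longrightarrow> boxsum [u, - v] = u"
  by (simp add: boxsum_diff)

lemma boxsum_diff_right: "\<bar>u\<bar> < \<bar>v\<bar> \<Longrightarrow> boxsum [u, - v] = - v"
  by (auto simp: boxsum_diff)

lemma boxsum_diff_swap: "boxsum [v, - u] = - boxsum [u, - v]"
  by (auto simp: boxsum_diff)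

text \<open>Two copies of \<open>p\<close> outnumber a single \<open>q\<close> even when
  \<open>q = - p\<close>; a single copy would be cancelled.\<close>

lemma boxsum_dominant_pair:
  assumes "\<bar>q\<bar> \<le> \<bar>p\<bar>"
  shows "boxsum [p, p, q, 0] = p"
proof (cases "p = 0")
  case True
  then show ?thesis using assms by (simp add: boxsum_def)
next
  case False
  then show ?thesis
    using assms by (auto intro!: boxsum_eqI)
qed

lemma boxsum_dominated_pair:
  assumes "\<bar>p\<bar> \<le> \<bar>q\<bar>" "q \<noteq> - p"
  shows "boxsum [p, p, q, 0] = q"
proof (cases "q = 0")
  case True
  then show ?thesis using assms by simp
next
  case False
  then show ?thesis
    using assms by (auto intro!: boxsum_eqI)
qed

section \<open>The limit form of \<open>a + b = c\<close>\<close>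

definition between_smiles :: "real \<Rightarrow> real \<Rightarrow> real \<Rightarrow> bool" where
  "between_smiles a b c \<longleftrightarrow> smile_minus a b \<le> c \<and> c \<le> smile_plus a b"

lemma between_smiles_iff:
  "between_smiles a b c \<longleftrightarrow>
     (if \<bar>b\<bar> < \<bar>a\<bar> then c = a else if \<bar>a\<bar> < \<bar>b\<bar> then c = b else if a = b then c = a else \<bar>c\<bar> \<le> \<bar>a\<bar>)"
  unfolding between_smiles_def smile_minus_def smile_plus_def by (auto simp: min_def abs_if split: if_splits)

lemma between_smiles_scale:
  assumes "k \<noteq> 0"
  shows "between_smiles (k * a) (k * b) (k * c) \<longleftrightarrow> between_smiles a b c"
  using assms by (simp add: between_smiles_iff abs_mult)

lemma between_smiles_commute: "between_smiles a b c \<longleftrightarrow> between_smiles b a c"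
  by (smt (verit) between_smiles_iff)

text \<open>If \<open>a \<noteq> c\<close>, then \<open>b\<close> is \<open>c\<close> or
  \<open>- a\<close> according to whether \<open>\<bar>c\<bar> > \<bar>a\<bar>\<close>; if
  \<open>a = c = 0\<close>, then \<open>b = 0\<close>. For \<open>a = c \<noteq> 0\<close> every
  \<open>b\<close> with \<open>\<bar>b\<bar> \<le> \<bar>a\<bar>\<close> is allowed, which is why
  the vertex needs separate treatment.\<close>

lemma between_smiles_unique:
  assumes "between_smiles a b c" "between_smiles a b' c" "a \<noteq> c \<or> c = 0"
  shows "b = b'"
  using assms by (smt (verit) between_smiles_iff)

section \<open>Limits of identities between odd powers\<close>

text \<open>A sum of two powers is at most twice the larger one, and the roots of 2 tend to
  1.\<close>

lemma odd_power_sum_limit_le_max: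
  fixes f g h :: "nat \<Rightarrow> real"
  assumes "f \<longlonglongrightarrow> a" "g \<longlonglongrightarrow> b" "h \<longlonglongrightarrow> c"
    and eq: "\<And>p. f p ^ (2 * p + 1) + g p ^ (2 * p + 1) = h p ^ (2 * p + 1)"
  shows "\<bar>c\<bar> \<le> max \<bar>a\<bar> \<bar>b\<bar>"
proof -
  let ?m = "\<lambda>p. max \<bar>f p\<bar> \<bar>g p\<bar>"
  have le: "\<bar>h p\<bar> \<le> root (2 * p + 1) 2 * ?m p" for p
  proof -
    have "\<bar>h p\<bar> ^ (2 * p + 1) \<le> \<bar>f p\<bar> ^ (2 * p + 1) + \<bar>g p\<bar> ^ (2 * p + 1)"
      unfolding power_abs[symmetric] eq[symmetric] by (rule abs_triangle_ineq)
    also have "\<dots> \<le> ?m p ^ (2 * p + 1) + ?m p ^ (2 * p + 1)"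
      by (intro add_mono power_mono) auto
    also have "\<dots> = (root (2 * p + 1) 2 * ?m p) ^ (2 * p + 1)"
      unfolding power_mult_distrib odd_real_root_pow[OF odd_two_times_plus_one] by (rule mult_2[symmetric])
    finally have "\<bar>h p\<bar> ^ Suc (2 * p) \<le> (root (2 * p + 1) 2 * ?m p) ^ Suc (2 * p)"
      by (simp only: Suc_eq_plus1)
    then show ?thesis
      by (rule power_le_imp_le_base) simp
  qed
  have "(\<lambda>p. root (2 * p + 1) 2) \<longlonglongrightarrow> sgn 2"
    by (rule root_odd_LIMSEQ) auto
  then have "(\<lambda>p. root (2 * p + 1) 2 * ?m p) \<longlonglongrightarrow> 1 * max \<bar>a\<bar> \<bar>b\<bar>"
    using assms(1,2) by (intro tendsto_intros) auto
  then show ?thesis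
    using le by (intro LIMSEQ_le[OF tendsto_rabs[OF assms(3)]]) auto
qed

lemma odd_power_sum_limit_le:
  fixes f g h :: "nat \<Rightarrow> real"
  assumes "f \<longlonglongrightarrow> a" "g \<longlonglongrightarrow> b" "h \<longlonglongrightarrow> c"
    and eq: "\<And>p. f p ^ (2 * p + 1) + g p ^ (2 * p + 1) = h p ^ (2 * p + 1)"
    and "b < 0"
  shows "c \<le> a"
proof (rule tendsto_le[OF _ assms(1,3)])
  have "\<forall>\<^sub>F p in sequentially. g p < 0"
    using assms(2) \<open>b < 0\<close> by (rule order_tendstoD)
  then show "\<forall>\<^sub>F p in sequentially. h p \<le> f p"
  proof eventually_elim
    case (elim p)
    then have "g p ^ (2 * p + 1) < 0"
      by (simp add: mult_neg_pos zero_less_power_eq)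
    then have "h p ^ (2 * p + 1) \<le> f p ^ (2 * p + 1)"
      using eq[of p] by linarith
    then show ?case
      using real_root_le_mono[of "2 * p + 1" "h p ^ (2 * p + 1)" "f p ^ (2 * p + 1)"]
      by (simp only: odd_real_root_power_cancel[OF odd_two_times_plus_one])
  qed
qed simp

lemma odd_power_sum_limit:
  fixes f g h :: "nat \<Rightarrow> real"
  assumes lim: "f \<longlonglongrightarrow> a" "g \<longlonglongrightarrow> b" "h \<longlonglongrightarrow> c"
    and eq: "\<And>p. f p ^ (2 * p + 1) + g p ^ (2 * p + 1) = h p ^ (2 * p + 1)"
  shows "between_smiles a b c"
proof -
  have upper: "c \<le> smile_plus a b"
    if lim: "f \<longlonglongrightarrow> a" "g \<longlonglongrightarrow> b" "h \<longlonglongrightarrow> c"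
    and eq: "\<And>p. f p ^ (2 * p + 1) + g p ^ (2 * p + 1) = h p ^ (2 * p + 1)"
    for f g h :: "nat \<Rightarrow> real" and a b c
  proof -
    \<comment> \<open>Odd powers absorb signs, so terms may change sides and both estimates apply to
      the rearranged identities.\<close>
    have eq': "g p ^ (2 * p + 1) + f p ^ (2 * p + 1) = h p ^ (2 * p + 1)"
      "h p ^ (2 * p + 1) + (- g p) ^ (2 * p + 1) = f p ^ (2 * p + 1)"
      "h p ^ (2 * p + 1) + (- f p) ^ (2 * p + 1) = g p ^ (2 * p + 1)"
      "f p ^ (2 * p + 1) + (- h p) ^ (2 * p + 1) = (- g p) ^ (2 * p + 1)"
      "g p ^ (2 * p + 1) + (- h p) ^ (2 * p + 1) = (- f p) ^ (2 * p + 1)" for p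
      using eq[of p] by simp_all
    have "\<bar>c\<bar> \<le> max \<bar>a\<bar> \<bar>b\<bar>"
      by (rule odd_power_sum_limit_le_max[OF lim eq])
    moreover have "b < 0 \<Longrightarrow> c \<le> a"
      by (rule odd_power_sum_limit_le[OF lim eq])
    moreover have "\<bar>a\<bar> \<le> max \<bar>c\<bar> \<bar>- b\<bar>"
      by (rule odd_power_sum_limit_le_max[OF lim(3) tendsto_minus[OF lim(2)] lim(1) eq'(2)])
    moreover have "\<bar>b\<bar> \<le> max \<bar>c\<bar> \<bar>- a\<bar>"
      by (rule odd_power_sum_limit_le_max[OF lim(3) tendsto_minus[OF lim(1)] lim(2) eq'(3)])
    moreover have "- c < 0 \<Longrightarrow> - b \<le> a"
      by (rule odd_power_sum_limit_le[OF lim(1) tendsto_minus[OF lim(3)] tendsto_minus[OF lim(2)] eq'(4)])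
    moreover have "- c < 0 \<Longrightarrow> - a \<le> b"
      by (rule odd_power_sum_limit_le[OF lim(2) tendsto_minus[OF lim(3)] tendsto_minus[OF lim(1)] eq'(5)])
    ultimately show ?thesis
      unfolding smile_plus_def smile_minus_def by (auto simp: min_def abs_if split: if_splits)
  qed
  \<comment> \<open>The lower bound is the upper bound for the negated sequences.\<close>
  have "(- f p) ^ (2 * p + 1) + (- g p) ^ (2 * p + 1) = (- h p) ^ (2 * p + 1)" for p
    using eq[of p] by simp
  from upper[OF lim[THEN tendsto_minus] this] upper[OF lim eq] show ?thesis
    by (simp add: between_smiles_def smile_plus_def)
qed

section \<open>The line in coordinates\<close>

text \<open>Scalar arguments turn the exchange of coordinates or of spanning points into a renaming
  of variables.\<close>

definition on_line :: "real \<Rightarrow> real \<Rightarrow> real \<Rightarrow> real \<Rightarrow> real \<Rightarrow> real \<Rightarrow> bool" where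
  "on_line x1 x2 y1 y2 z1 z2 \<longleftrightarrow> (\<exists>t r s w. boxsum [t, r, s, w] = 1 \<and>
     boxsum [t * x1, r * x1, s * y1, w * y1] = z1 \<and> boxsum [t * x2, r * x2, s * y2, w * y2] = z2)"

lemma on_lineI:
  assumes "boxsum [t, r, s, w] = 1" "boxsum [t * x1, r * x1, s * y1, w * y1] = z1"
    "boxsum [t * x2, r * x2, s * y2, w * y2] = z2"
  shows "on_line x1 x2 y1 y2 z1 z2"
  using assms unfolding on_line_def by blast

lemma digamma_line_eq:
  "digamma_line x y = {z. on_line (x $ 1) (x $ 2) (y $ 1) (y $ 2) (z $ 1) (z $ 2)}"
proof -
  have "boxsum_vec [t *\<^sub>R x, r *\<^sub>R x, s *\<^sub>R y, w *\<^sub>R y] = z \<longleftrightarrow>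
      boxsum [t * x $ 1, r * x $ 1, s * y $ 1, w * y $ 1] = z $ 1 \<and>
      boxsum [t * x $ 2, r * x $ 2, s * y $ 2, w * y $ 2] = z $ 2" for t r s w and z :: "real ^ 2"
    by (simp add: boxsum_vec_def vec_eq_iff forall_2)
  from this[symmetric] show ?thesis
    unfolding digamma_line_def on_line_def by (simp only:) blast
qed

lemma on_line_swap_coordinates: "on_line x1 x2 y1 y2 z1 z2 \<longleftrightarrow> on_line x2 x1 y2 y1 z2 z1"
  unfolding on_line_def by blast

lemma on_line_swap_points: "on_line x1 x2 y1 y2 z1 z2 \<longleftrightarrow> on_line y1 y2 x1 x2 z1 z2"
proof -
  have "boxsum [a, b, c, d] = boxsum [c, d, a, b]" for a b c d
    by (rule boxsum_cong) simp
  then show ?thesis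
    unfolding on_line_def by metis
qed

lemma on_line_imp_between_smiles:
  assumes "on_line x1 x2 y1 y2 z1 z2"
  shows "between_smiles (boxsum [y2, - x2] * z1) (boxsum [x1, - y1] * z2) (boxsum [x1 * y2, - (x2 * y1)])"
proof -
  obtain t r s w where one: "boxsum [t, r, s, w] = 1"
    and z1: "boxsum [t * x1, r * x1, s * y1, w * y1] = z1"
    and z2: "boxsum [t * x2, r * x2, s * y2, w * y2] = z2"
    using assms unfolding on_line_def by blast
  \<comment> \<open>Before the limit, the powers of \<open>S\<close> are exact power sums, so the
    classical identity holds for each \<open>p\<close>.\<close>
  define S where "S us p = root (2 * p + 1) (\<Sum>u\<leftarrow>us. u ^ (2 * p + 1))" for us p
  have S: "S us \<longlonglongrightarrow> boxsum us" for us
    unfolding S_def by (rule boxsum_tendsto)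
  have S_pow: "S us p ^ (2 * p + 1) = (\<Sum>u\<leftarrow>us. u ^ (2 * p + 1))" for us p
    unfolding S_def by (rule odd_real_root_pow[OF odd_two_times_plus_one])
  have "between_smiles (boxsum [y2, - x2] * boxsum [t * x1, r * x1, s * y1, w * y1])
     (boxsum [x1, - y1] * boxsum [t * x2, r * x2, s * y2, w * y2])
     (boxsum [x1 * y2, - (x2 * y1)] * boxsum [t, r, s, w])"
    by (rule odd_power_sum_limit[OF tendsto_mult[OF S S] tendsto_mult[OF S S] tendsto_mult[OF S S]])
      (unfold power_mult_distrib S_pow, simp add: algebra_simps)
  then show ?thesis
    by (simp add: one z1 z2)
qed

text \<open>The parameters solve \<open>z\<^sub>1 = T x\<^sub>1 + S y\<^sub>1\<close>, \<open>T + S = 1\<close> classically: \<open>T\<close> is split into the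
  two terms of \<open>(z\<^sub>1 - y\<^sub>1) / (x\<^sub>1 - y\<^sub>1)\<close>, and \<open>S\<close> into those of \<open>(x\<^sub>1 - z\<^sub>1) / (x\<^sub>1 - y\<^sub>1)\<close>.\<close>

lemma on_line_prescribed_coordinate:
  assumes "x1 \<noteq> y1"
  obtains z2 where "on_line x1 x2 y1 y2 z1 z2"
proof -
  \<comment> \<open>The box sum replaces the classical denominator \<open>x1 - y1\<close>.\<close>
  define k where "k = inverse (boxsum [x1, - y1])"
  have k: "k * boxsum [x1, - y1] = 1"
    using assms by (auto simp: k_def boxsum_diff split: if_splits)
  have "boxsum [k * z1, k * - y1, k * x1, k * - z1] = k * boxsum [x1, - y1]"
    unfolding boxsum_scale[symmetric] by (rule boxsum_cong) (simp add: power_mult_distrib)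
  moreover have "boxsum [k * z1 * x1, k * - y1 * x1, k * x1 * y1, k * - z1 * y1]
      = (k * z1) * boxsum [x1, - y1]"
    unfolding boxsum_scale[symmetric] by (rule boxsum_cong) (simp add: power_mult_distrib)
  ultimately have "boxsum [k * z1, k * - y1, k * x1, k * - z1] = 1"
    "boxsum [k * z1 * x1, k * - y1 * x1, k * x1 * y1, k * - z1 * y1] = z1"
    using k by (simp_all only: mult.assoc mult.left_commute[of k] mult_1_right)
  from on_lineI[OF this refl] show ?thesis
    by (rule that)
qed

section \<open>Explicit parameters for the vertex\<close>

text \<open>Two copies of one point and one of the other suffice. The doubled point wins a tie of
  opposite entries, which is harmful only in the coordinate where the other point should prevail;
  such ties in both coordinates would give \<open>x1 * y2 = x2 * y1\<close>.\<close>

lemma on_line_vertex_opposite: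
  assumes "\<bar>x2\<bar> \<le> \<bar>y2\<bar>" "\<bar>y1\<bar> \<le> \<bar>x1\<bar>" "x1 * y2 \<noteq> x2 * y1"
  shows "on_line x1 x2 y1 y2 x1 y2"
proof -
  have one: "boxsum [1, 1, 1, 0] = (1 :: real)"
    by (rule boxsum_dominant_pair) simp
  consider "y2 \<noteq> - x2" | "x1 \<noteq> - y1"
    using assms(3) by fastforce
  then show ?thesis
  proof cases
    case 1
    have "boxsum [x1, x1, y1, 0] = x1" "boxsum [x2, x2, y2, 0] = y2"
      using boxsum_dominant_pair[OF assms(2)] boxsum_dominated_pair[OF assms(1) 1] by this+
    with one show ?thesis
      by (intro on_lineI[of 1 1 1 0]) (simp_all only: mult_1_left mult_zero_left)
  next
    case 2
    have "boxsum [y1, y1, x1, 0] = x1" "boxsum [y2, y2, x2, 0] = y2"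
      using boxsum_dominated_pair[OF assms(2) 2] boxsum_dominant_pair[OF assms(1)] by this+
    with one show ?thesis
      by (subst on_line_swap_points, intro on_lineI[of 1 1 1 0]) (simp_all only: mult_1_left mult_zero_left)
  qed
qed

text \<open>The second point is scaled to have first coordinate \<open>- x1\<close>, which loses
  against two copies of \<open>x1\<close>, while its second coordinate prevails over
  \<open>x2\<close>. The factor is at most 1 in absolute value, so the parameters have box sum
  1.\<close>

lemma on_line_vertex_same:
  assumes "x1 \<noteq> y1" "\<bar>x1\<bar> \<le> \<bar>y1\<bar>" "\<bar>x2 * y1\<bar> \<le> \<bar>x1 * y2\<bar>" "x1 * y2 \<noteq> x2 * y1"
  shows "on_line x1 x2 y1 y2 x1 (- (x1 * y2) / y1)"
proof -
  have y1: "y1 \<noteq> 0" using assms(1,2) by auto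
  have "\<bar>- x1 / y1\<bar> \<le> 1"
    using y1 assms(2) by (simp add: abs_divide)
  then have 1: "boxsum [1, 1, - x1 / y1, 0] = 1"
    by (intro boxsum_dominant_pair) simp
  have 2: "boxsum [x1, x1, - x1, 0] = x1"
    by (rule boxsum_dominant_pair) simp
  have "\<bar>x2\<bar> \<le> \<bar>- (x1 * y2) / y1\<bar>"
    using y1 assms(3) by (simp add: abs_divide abs_mult pos_le_divide_eq)
  moreover have "- (x1 * y2) / y1 \<noteq> - x2"
    using y1 assms(4) by (simp add: nonzero_divide_eq_eq)
  ultimately have 3: "boxsum [x2, x2, - (x1 * y2) / y1, 0] = - (x1 * y2) / y1"
    by (rule boxsum_dominated_pair)
  have "- x1 / y1 * y1 = - x1" "- x1 / y1 * y2 = - (x1 * y2) / y1"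
    using y1 by simp_all
  with 1 2 3 show ?thesis
    by (intro on_lineI[of 1 1 "- x1 / y1" 0]) (simp_all only: mult_1_left mult_zero_left)
qed

lemma on_line_vertex:
  assumes a1: "boxsum [y2, - x2] * z1 = c" and a2: "boxsum [x1, - y1] * z2 = c"
    and c: "c = boxsum [x1 * y2, - (x2 * y1)]" "c \<noteq> 0"
  shows "on_line x1 x2 y1 y2 z1 z2"
proof -
  have ne: "x2 \<noteq> y2" "x1 \<noteq> y1" "x1 * y2 \<noteq> x2 * y1"
    using assms by (auto simp: boxsum_diff)
  \<comment> \<open>Here the second point dominates both coordinates; the larger product in
    \<open>c\<close> decides which coordinate \<open>z\<close> shares with the first point.\<close>
  have mixed: "on_line x1 x2 y1 y2 z1 z2"
    if "\<bar>x2\<bar> \<le> \<bar>y2\<bar>" "\<bar>x1\<bar> \<le> \<bar>y1\<bar>" and ne: "x2 \<noteq> y2" "x1 \<noteq> y1" "x1 * y2 \<noteq> x2 * y1"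
      and z: "y2 * z1 = c" "- y1 * z2 = c"
      and c: "c = (if \<bar>x2 * y1\<bar> \<le> \<bar>x1 * y2\<bar> then x1 * y2 else - (x2 * y1))"
    for x1 x2 y1 y2 z1 z2 c :: real
  proof -
    have y: "y1 \<noteq> 0" "y2 \<noteq> 0" using that by auto
    show ?thesis
    proof (cases "\<bar>x2 * y1\<bar> \<le> \<bar>x1 * y2\<bar>")
      case True
      then have c': "c = x1 * y2"
        using c by simp
      have "y2 * z1 = y2 * x1" "z2 * y1 = - (x1 * y2)"
        using z unfolding c' by (simp_all add: mult.commute)
      then have "z1 = x1" "z2 = - (x1 * y2) / y1"
        using y by (simp_all only: nonzero_eq_divide_eq mult_cancel_left simp_thms)
      then show ?thesis
        using on_line_vertex_same[of x1 y1 x2 y2] True that by simp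
    next
      case False
      then have c': "c = - (x2 * y1)"
        using c by simp
      have "y1 * z2 = y1 * x2" "z1 * y2 = - (x2 * y1)"
        using z unfolding c' by (simp_all add: mult.commute)
      then have "z2 = x2" "z1 = - (x2 * y1) / y2"
        using y by (simp_all only: nonzero_eq_divide_eq mult_cancel_left simp_thms)
      then show ?thesis
        using on_line_vertex_same[of x2 y2 x1 y1] False that
        by (subst on_line_swap_coordinates) simp
    qed
  qed
  consider "\<bar>x2\<bar> \<le> \<bar>y2\<bar>" "\<bar>y1\<bar> \<le> \<bar>x1\<bar>" | "\<bar>y2\<bar> < \<bar>x2\<bar>" "\<bar>x1\<bar> < \<bar>y1\<bar>"
    | "\<bar>x2\<bar> \<le> \<bar>y2\<bar>" "\<bar>x1\<bar> < \<bar>y1\<bar>" | "\<bar>y2\<bar> < \<bar>x2\<bar>" "\<bar>y1\<bar> \<le> \<bar>x1\<bar>"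
    by linarith
  then show ?thesis
  proof cases
    case 1
    then have "\<bar>x2 * y1\<bar> \<le> \<bar>x1 * y2\<bar>"
      unfolding abs_mult by (subst mult.commute) (intro mult_mono; simp)
    then have "c = x1 * y2" "boxsum [y2, - x2] = y2" "boxsum [x1, - y1] = x1"
      using 1 c(1) ne by (simp_all only: boxsum_diff_left less_imp_le ne ne(1)[symmetric] not_False_eq_True)
    then have "z1 = x1" "z2 = y2"
      using a1 a2 c(2) by simp_all
    then show ?thesis
      using 1 ne on_line_vertex_opposite by simp
  next
    case 2
    then have "\<bar>x1 * y2\<bar> < \<bar>x2 * y1\<bar>"
      unfolding abs_mult by (subst (2) mult.commute) (intro mult_strict_mono'; simp)
    then have "c = - (x2 * y1)" "boxsum [y2, - x2] = - x2" "boxsum [x1, - y1] = - y1"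
      using 2 c(1) by (simp_all only: boxsum_diff_left boxsum_diff_right less_imp_le ne ne(1)[symmetric] not_False_eq_True)
    then have "z1 = y1" "z2 = x2"
      using a1 a2 c(2) by simp_all
    moreover have "y1 * x2 \<noteq> y2 * x1"
      using ne(3)[symmetric] unfolding mult.commute[of y1] mult.commute[of y2] .
    ultimately show ?thesis
      using on_line_vertex_opposite[of y2 x2 x1 y1] 2
      by (subst on_line_swap_points) (simp only: less_imp_le simp_thms)
  next
    case 3
    then have "boxsum [y2, - x2] = y2" "boxsum [x1, - y1] = - y1"
      using ne(1) by (simp_all only: boxsum_diff_left boxsum_diff_right not_False_eq_True)
    then have "y2 * z1 = c" "- y1 * z2 = c"
      using a1 a2 by simp_all
    moreover have "c = (if \<bar>x2 * y1\<bar> \<le> \<bar>x1 * y2\<bar> then x1 * y2 else - (x2 * y1))"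
      using ne(3) by (simp only: c(1) boxsum_diff if_False)
    ultimately show ?thesis
      using 3(1) less_imp_le[OF 3(2)] ne by (intro mixed[of x2 y2 x1 y1 z1 c z2])
  next
    case 4
    then have "boxsum [y2, - x2] = - x2" "boxsum [x1, - y1] = x1"
      using ne(2) by (simp_all only: boxsum_diff_left boxsum_diff_right not_False_eq_True)
    \<comment> \<open>Exchanging the two points negates both coefficients and \<open>c\<close>, so
      \<open>mixed\<close> applies.\<close>
    then have "x2 * z1 = - c" "- x1 * z2 = - c"
      using a1 a2 by simp_all
    moreover have "- c = (if \<bar>y2 * x1\<bar> \<le> \<bar>y1 * x2\<bar> then y1 * x2 else - (y2 * x1))"
      unfolding c(1) boxsum_diff_swap[symmetric]
      unfolding boxsum_diff mult.commute[of y1] mult.commute[of y2]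
      by (simp only: ne(3)[symmetric] if_False)
    moreover have "y1 * x2 \<noteq> y2 * x1"
      using ne(3)[symmetric] unfolding mult.commute[of y1] mult.commute[of y2] .
    ultimately have "on_line y1 y2 x1 x2 z1 z2"
      using less_imp_le[OF 4(1)] 4(2) ne(1,2)[symmetric] by (intro mixed[of y2 x2 y1 x1 z1 "- c" z2])
    then show ?thesis
      by (subst on_line_swap_points)
  qed
qed

section \<open>Inequalities for one line and for parallel lines\<close>

lemma on_line_iff:
  assumes "x1 \<noteq> y1 \<or> x2 \<noteq> y2"
  shows "on_line x1 x2 y1 y2 z1 z2 \<longleftrightarrow>
    between_smiles (boxsum [y2, - x2] * z1) (boxsum [x1, - y1] * z2) (boxsum [x1 * y2, - (x2 * y1)])"
    (is "_ \<longleftrightarrow> between_smiles (?a1 * z1) (?a2 * z2) ?c")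
proof
  assume R: "between_smiles (?a1 * z1) (?a2 * z2) ?c"
  have a1: "?a1 = 0 \<longleftrightarrow> x2 = y2" and a2: "?a2 = 0 \<longleftrightarrow> x1 = y1"
    by (auto simp: boxsum_diff)
  \<comment> \<open>If one coefficient vanishes, its product is 0, which either differs from
    \<open>?c\<close> or forces \<open>?c = 0\<close>; so one of the first two cases
    applies.\<close>
  consider "?a2 \<noteq> 0" "?a1 * z1 \<noteq> ?c \<or> ?c = 0" | "?a1 \<noteq> 0" "?a2 * z2 \<noteq> ?c \<or> ?c = 0"
    | "?a1 * z1 = ?c" "?a2 * z2 = ?c" "?c \<noteq> 0"
    using assms a1 a2 by fastforce
  then show "on_line x1 x2 y1 y2 z1 z2"
  proof cases
    case 1
    obtain z2' where z2': "on_line x1 x2 y1 y2 z1 z2'"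
      using 1 a2 on_line_prescribed_coordinate by blast
    have "?a2 * z2 = ?a2 * z2'"
      using R on_line_imp_between_smiles[OF z2'] 1(2) by (rule between_smiles_unique)
    then show ?thesis using z2' 1 by simp
  next
    case 2
    obtain z1' where z1': "on_line x1 x2 y1 y2 z1' z2"
      using 2 a1 on_line_prescribed_coordinate on_line_swap_coordinates by metis
    have "?a1 * z1 = ?a1 * z1'"
      using R on_line_imp_between_smiles[OF z1'] 2(2)
      by (subst (asm) (1 2) between_smiles_commute) (rule between_smiles_unique)
    then show ?thesis using z1' 2 by simp
  next
    case 3
    then show ?thesis by (intro on_line_vertex) auto
  qed
qed (rule on_line_imp_between_smiles)

text \<open>Dividing by \<open>k\<close> leaves coefficients that depend only on the direction
  \<open>v\<close>, hence are common to parallel lines.\<close>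

lemma digamma_line_between_smiles:
  assumes "x \<noteq> y" and a: "x \<boxminus> y = k *\<^sub>R v" "k \<noteq> 0"
  shows "digamma_line x y = {z. between_smiles (- (v $ 2) * z $ 1) (v $ 1 * z $ 2)
           (boxsum [x $ 1 * y $ 2, - (x $ 2 * y $ 1)] / k)}"
proof -
  have "boxsum [y $ 2, - (x $ 2)] = k * - (v $ 2)" "boxsum [x $ 1, - (y $ 1)] = k * v $ 1"
    using arg_cong[OF a(1), of "\<lambda>u. u $ 1"] arg_cong[OF a(1), of "\<lambda>u. u $ 2"]
    by (simp_all add: boxminus_vec_def boxsum_vec_def boxsum_diff_swap[of "y $ 2"])
  moreover have "x $ 1 \<noteq> y $ 1 \<or> x $ 2 \<noteq> y $ 2"
    using assms(1) by (simp add: vec_eq_iff forall_2)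
  ultimately show ?thesis
    using between_smiles_scale[OF a(2), of "- (v $ 2) * z $ 1" "v $ 1 * z $ 2"
        "boxsum [x $ 1 * y $ 2, - (x $ 2 * y $ 1)] / k" for z :: "real ^ 2"] a(2)
    by (simp add: digamma_line_eq on_line_iff mult.assoc)
qed

theorem lemma4p3p2:
  fixes D E :: "(real ^ 2) set"
  assumes "digamma_parallel D E"
  shows "\<exists>(a :: real ^ 2) (c :: real) (d :: real).
           D = {z. inner_minus a z \<le> c \<and> c \<le> inner_plus a z} \<and>
           E = {z. inner_minus a z \<le> d \<and> d \<le> inner_plus a z}"
proof -
  obtain x y u v \<alpha> where D: "x \<noteq> y" "D = digamma_line x y" and E: "u \<noteq> v" "E = digamma_line u v"
    and \<alpha>: "\<alpha> \<noteq> 0" "x \<boxminus> y = \<alpha> *\<^sub>R (u \<boxminus> v)"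
    using assms unfolding digamma_parallel_def by blast
  \<comment> \<open>The direction of \<open>E\<close> serves for both lines, with factor 1 for
    \<open>E\<close> and \<open>\<alpha>\<close> for \<open>D\<close>.\<close>
  define a :: "real ^ 2" where "a = vector [- ((u \<boxminus> v) $ 2), (u \<boxminus> v) $ 1]"
  show ?thesis
    using digamma_line_between_smiles[OF D(1) \<alpha>(2,1)] digamma_line_between_smiles[OF E(1), of 1 "u \<boxminus> v"]
    by (intro exI[of _ a] exI conjI)
      (simp_all add: D(2) E(2) between_smiles_def inner_minus_def inner_plus_def a_def)
qed

end
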